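(* For every integer $m\ge 1$, $WAR(Pm(FP))=1$.
   Context: Scheduling setting: $n$ jobs $J_1,\dots,J_n$, $m$ identical machines $M_1,\dots,M_m$; job $J_j$ has processing time $p_j>0$ on every machine. $Pm(FP)$ is the fractional problem: each job may be partitioned into parts which may be processed on different machines, even concurrently; each machine processes at most one job at any time; schedules start at time $0$. For a feasible schedule $S$, the load $L^S_i$ of $M_i$ is the time by which $M_i$ finishes all processing assigned to it, and $L(S)=(L^S_1,\dots,L^S_m)$. For $X\in\mathbb{R}^m$ let $\overleftarrow{X}$ be $X$ sorted in non-increasing order and $\sigma(X)$ the prefix-sum vector; $X\preceq_s Y$ means $\sigma(\overleftarrow{X})\le\sigma(\overleftarrow{Y})$ coordinatewise. For an instance $\mathcal{I}$ with feasible schedules $\mathcal{S}$ and $S\in\mathcal{S}$, $s(S)$ is the infimum of $\alpha$ with $L(S)\preceq_s\alpha L(T)$ for all $T\in\mathcal{S}$, $s^*(\mathcal{I})=\inf_{S\in\mathcal{S}}s(S)$, and $WAR(\mathcal{P})=\sup_{\mathcal{I}}s^*(\mathcal{I})$ over all instances of problem $\mathcal{P}$ (with $m$ fixed). *)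

theory Defs
  imports "HOL-Library.Extended_Real"
begin

definition desc_sort :: "real list \<Rightarrow> real list" where
  "desc_sort X = rev (sort X)"

definition prefix_sums :: "real list \<Rightarrow> real list" where
  "prefix_sums X = map (\<lambda>k. sum_list (take (Suc k) X)) [0..<length X]"

definition s_le :: "real list \<Rightarrow> real list \<Rightarrow> bool"  (infix \<open>\<preceq>\<^sub>s\<close> 50) where
  "X \<preceq>\<^sub>s Y \<longleftrightarrow> list_all2 (\<le>) (prefix_sums (desc_sort X)) (prefix_sums (desc_sort Y))"

record ('i, 's) sched_problem =
  instances :: "'i set"
  feasible :: "'i \<Rightarrow> 's set"
  loads :: "'s \<Rightarrow> real list"

text \<open>The infima and suprema are taken in the extended reals, so an empty set of admissible
  factors gives the value infinity.\<close>

definition s_ratio :: "('i, 's) sched_problem \<Rightarrow> 'i \<Rightarrow> 's \<Rightarrow> ereal" where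
  "s_ratio P I S =
     (INF \<alpha> \<in> {\<alpha> :: real. \<forall>T \<in> feasible P I. loads P S \<preceq>\<^sub>s map (\<lambda>x. \<alpha> * x) (loads P T)}. ereal \<alpha>)"

definition s_star :: "('i, 's) sched_problem \<Rightarrow> 'i \<Rightarrow> ereal" where
  "s_star P I = (INF S \<in> feasible P I. s_ratio P I S)"

definition WAR :: "('i, 's) sched_problem \<Rightarrow> ereal" where
  "WAR P = (SUP I \<in> instances P. s_star P I)"

text \<open>A part of a job is processed without interruption on one machine during
  the time interval from \<open>start\<close> to \<open>finish\<close>. Jobs and machines are numbered from 0.
  An instance is the list of processing times of the jobs. Idle time is allowed, and parts of
  the same job on different machines may overlap in time.\<close>

record part =
  job :: nat
  machine :: nat
  start :: real
  finish :: real

definition FP_instances :: "real list set" where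
  "FP_instances = {p. p \<noteq> [] \<and> (\<forall>j < length p. p ! j > 0)}"

definition FP_schedules :: "nat \<Rightarrow> real list \<Rightarrow> part set set" where
  "FP_schedules m p = {S. finite S
     \<and> (\<forall>a \<in> S. job a < length p \<and> machine a < m \<and> 0 \<le> start a \<and> start a < finish a)
     \<and> (\<forall>a \<in> S. \<forall>b \<in> S. a \<noteq> b \<and> machine a = machine b \<longrightarrow>
          {start a..<finish a} \<inter> {start b..<finish b} = {})
     \<and> (\<forall>j < length p. (\<Sum>a \<in> {a \<in> S. job a = j}. finish a - start a) = p ! j)}"

definition machine_load :: "part set \<Rightarrow> nat \<Rightarrow> real" where
  "machine_load S i = Max (insert 0 (finish ` {a \<in> S. machine a = i}))"

definition Pm_FP :: "nat \<Rightarrow> (real list, part set) sched_problem" where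
  "Pm_FP m = \<lparr>instances = FP_instances, feasible = FP_schedules m,
     loads = (\<lambda>S. map (machine_load S) [0..<m])\<rparr>"

end

theory Submission imports Defs "HOL-Library.Multiset" begin

text \<open>Cutting every job into \<open>m\<close> equal parts, one per machine, gives all machines the load
  \<open>P / m\<close>, where \<open>P\<close> is the total processing time. In any schedule the loads add up to at least
  \<open>P\<close>, and the \<open>k\<close> largest of \<open>m\<close> numbers have at least the fraction \<open>k / m\<close> of their sum, so
  the balanced schedule has ratio at most 1. Conversely no schedule has ratio below 1, as seen by
  comparing its total load with itself.\<close>

lemma sum_list_desc_sort [simp]: "sum_list (desc_sort X) = sum_list X"
  by (metis desc_sort_def mset_rev mset_sort sum_mset_sum_list)

lemma length_desc_sort [simp]: "length (desc_sort X) = length X"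
  by (simp add: desc_sort_def)

lemma s_le_iff_prefix:
  assumes "length X = length Y"
  shows "X \<preceq>\<^sub>s Y \<longleftrightarrow>
    (\<forall>k < length X. sum_list (take (Suc k) (desc_sort X)) \<le> sum_list (take (Suc k) (desc_sort Y)))"
  using assms by (auto simp: s_le_def prefix_sums_def list_all2_conv_all_nth)

text \<open>The last prefix sum, at index \<open>length X - 1\<close>, is the total of the sorted
  list, and sorting preserves totals.\<close>

lemma s_le_imp_sum_list_le:
  assumes "X \<preceq>\<^sub>s Y" "length X = length Y"
  shows "sum_list X \<le> sum_list Y"
proof (cases "length X = 0")
  case False
  then show ?thesis
    using assms(1)[unfolded s_le_iff_prefix[OF assms(2)], rule_format, of "length X - 1"] assms(2)
    by simp
qed (use assms in auto)

lemma sum_list_ge_const: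
  fixes xs :: "real list" and c :: real
  assumes "\<And>x. x \<in> set xs \<Longrightarrow> c \<le> x"
  shows "length xs * c \<le> sum_list xs"
  using assms by (induction xs) (auto simp: algebra_simps add_mono)

lemma sum_list_le_const:
  fixes xs :: "real list" and c :: real
  assumes "\<And>x. x \<in> set xs \<Longrightarrow> x \<le> c"
  shows "sum_list xs \<le> length xs * c"
  using assms by (induction xs) (auto simp: algebra_simps add_mono)

text \<open>The entry \<open>Z ! k\<close> is a threshold: everything before it is at least as
  large, everything from it on at most as large. The average of a prefix is therefore at least the
  overall average, stated without division.\<close>

lemma sum_list_take_desc_ge:
  fixes Z :: "real list"
  assumes "sorted_wrt (\<ge>) Z" "k \<le> length Z"
  shows "real k * sum_list Z \<le> real (length Z) * sum_list (take k Z)"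
proof (cases "k = length Z")
  case False
  with assms have k: "k < length Z" by simp
  have split: "sorted_wrt (\<ge>) (take k Z @ drop k Z)" using assms by simp
  have drop: "drop k Z = Z ! k # drop (Suc k) Z" using k by (simp add: Cons_nth_drop_Suc)
  have take_ge: "real k * (Z ! k) \<le> sum_list (take k Z)"
    using sum_list_ge_const[of "take k Z" "Z ! k"] split k
    unfolding sorted_wrt_append drop by simp
  have drop_le: "sum_list (drop k Z) \<le> real (length Z - k) * (Z ! k)"
    using sum_list_le_const[of "drop k Z" "Z ! k"] split k
    unfolding sorted_wrt_append drop by auto
  \<comment> \<open>Both sides are compared with \<open>k * (length Z - k) * Z ! k\<close>.\<close>
  have "real k * sum_list (drop k Z) \<le> real (length Z - k) * sum_list (take k Z)"
    using mult_left_mono[OF drop_le, of k] mult_left_mono[OF take_ge, of "length Z - k"]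
    by (simp add: mult.left_commute)
  moreover have "sum_list Z = sum_list (take k Z) + sum_list (drop k Z)"
    by (metis append_take_drop_id sum_list_append)
  ultimately show ?thesis using k by (simp add: algebra_simps of_nat_diff)
qed simp

lemma replicate_s_le:
  fixes Y :: "real list"
  assumes "length Y = m" "real m * c \<le> sum_list Y"
  shows "replicate m c \<preceq>\<^sub>s Y"
proof -
  have sort: "desc_sort (replicate m c) = replicate m c"
    by (simp add: desc_sort_def sorted_sort_id)
  have "Suc k * c \<le> sum_list (take (Suc k) (desc_sort Y))" if "k < m" for k
  proof -
    have "sorted_wrt (\<ge>) (desc_sort Y)"
      by (simp add: desc_sort_def sorted_wrt_rev)
    then have "Suc k * sum_list Y \<le> m * sum_list (take (Suc k) (desc_sort Y))"
      using sum_list_take_desc_ge[of "desc_sort Y" "Suc k"] that assms by simp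
    \<comment> \<open>Chaining through \<open>Suc k * sum_list Y\<close> leaves a common factor
      \<open>m\<close>, which cancels because \<open>k < m\<close> makes it positive.\<close>
    moreover have "real (Suc k) * (m * c) \<le> Suc k * sum_list Y"
      using assms(2) by (intro mult_left_mono) auto
    ultimately have "m * (Suc k * c) \<le> m * sum_list (take (Suc k) (desc_sort Y))"
      by (simp add: algebra_simps)
    then show ?thesis using that by simp
  qed
  then show ?thesis
    using assms(1) by (simp add: s_le_iff_prefix sort sum_list_replicate min_def algebra_simps)
qed

text \<open>Intervals are added in order of left endpoint. All earlier ones end by the start
  \<open>l x\<close> of the newest, so the induction hypothesis applies with bound
  \<open>l x\<close>, which is why \<open>L\<close> is generalized; the newest adds at most
  \<open>L - l x\<close>.\<close>

lemma sum_disjoint_intervals_le: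
  fixes l u :: "'a \<Rightarrow> real"
  assumes "finite A" "0 \<le> L"
    and "\<And>a. a \<in> A \<Longrightarrow> 0 \<le> l a \<and> l a < u a \<and> u a \<le> L"
    and "\<And>a b. \<lbrakk>a \<in> A; b \<in> A; a \<noteq> b\<rbrakk> \<Longrightarrow> {l a..<u a} \<inter> {l b..<u b} = {}"
  shows "(\<Sum>a\<in>A. u a - l a) \<le> L"
  using assms
proof (induction A arbitrary: L rule: finite_ranking_induct[where f = l])
  case (insert x A)
  \<comment> \<open>The ranking induction does not provide that \<open>x\<close> is new.\<close>
  show ?case
  proof (cases "x \<in> A")
    case True
    then show ?thesis using insert by (simp add: insert_absorb)
  next
    case False
    have x: "0 \<le> l x" "l x < u x" "u x \<le> L" using insert.prems(2) by auto
    have before: "u a \<le> l x" if "a \<in> A" for a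
    proof (rule ccontr)
      \<comment> \<open>Since \<open>l a\<close> \<le> \<open>l x\<close>, the point
        \<open>l x\<close> would lie in both half-open intervals.\<close>
      assume "\<not> u a \<le> l x"
      then have "l x \<in> {l a..<u a} \<inter> {l x..<u x}" using x insert.hyps(2)[OF that] by auto
      then show False using insert.prems(3)[of a x] that False by auto
    qed
    have "(\<Sum>a\<in>A. u a - l a) \<le> l x"
    proof (rule insert.IH)
      show "0 \<le> l x" by (rule x)
      show "0 \<le> l a \<and> l a < u a \<and> u a \<le> l x" if "a \<in> A" for a
        using insert.prems(2)[of a] before that by blast
      show "{l a..<u a} \<inter> {l b..<u b} = {}" if "a \<in> A" "b \<in> A" "a \<noteq> b" for a b
        using insert.prems(3)[of a b] that by blast
    qed
    then show ?thesis using False insert.hyps x by simp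
  qed
qed simp

lemma sum_nth_eq_sum_list: "(\<Sum>j<length p. p ! j) = sum_list p"
  by (metis atLeast0LessThan sum_list_sum_nth)

text \<open>Double counting: the total duration of all parts is grouped once by job, giving the
  processing times, and once by machine, where disjoint parts fit below the load. Idle time makes
  this an inequality.\<close>

lemma sum_processing_le_sum_loads:
  assumes "S \<in> FP_schedules m p"
  shows "sum_list p \<le> (\<Sum>i<m. machine_load S i)"
proof -
  have S: "finite S"
    "\<And>a. a \<in> S \<Longrightarrow> job a < length p \<and> machine a < m \<and> 0 \<le> start a \<and> start a < finish a"
    "\<And>a b. \<lbrakk>a \<in> S; b \<in> S; a \<noteq> b; machine a = machine b\<rbrakk> \<Longrightarrow>
      {start a..<finish a} \<inter> {start b..<finish b} = {}"
    "\<And>j. j < length p \<Longrightarrow> (\<Sum>a | a \<in> S \<and> job a = j. finish a - start a) = p ! j"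
    using assms by (auto simp: FP_schedules_def)
  have "sum_list p = (\<Sum>j<length p. \<Sum>a | a \<in> S \<and> job a = j. finish a - start a)"
    using S(4) by (simp add: sum_nth_eq_sum_list[symmetric])
  also have "\<dots> = (\<Sum>a\<in>S. finish a - start a)"
    using S(1,2) by (intro sum.group) auto
  also have "\<dots> = (\<Sum>i<m. \<Sum>a | a \<in> S \<and> machine a = i. finish a - start a)"
    using S(1,2) by (intro sum.group[symmetric]) auto
  also have "\<dots> \<le> (\<Sum>i<m. machine_load S i)"
  proof (intro sum_mono sum_disjoint_intervals_le)
    fix i
    show "0 \<le> machine_load S i" using S(1) by (simp add: machine_load_def)
    fix a assume "a \<in> {a \<in> S. machine a = i}"
    then show "0 \<le> start a \<and> start a < finish a \<and> finish a \<le> machine_load S i"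
      using S(1,2) by (auto simp: machine_load_def intro!: Max_ge)
  qed (use S in auto)
  finally show ?thesis .
qed

text \<open>Every machine runs the jobs by increasing index without idle time, each job taking
  \<open>p ! j / m\<close>; hence the endpoints are scaled prefix sums of \<open>p\<close>.\<close>

definition even_part :: "nat \<Rightarrow> real list \<Rightarrow> nat \<Rightarrow> nat \<Rightarrow> part" where
  "even_part m p j i = \<lparr>job = j, machine = i,
     start = sum_list (take j p) / m, finish = sum_list (take (Suc j) p) / m\<rparr>"

definition even_schedule :: "nat \<Rightarrow> real list \<Rightarrow> part set" where
  "even_schedule m p = (\<lambda>(j, i). even_part m p j i) ` ({..<length p} \<times> {..<m})"

lemma finite_even_schedule: "finite (even_schedule m p)"
  by (simp add: even_schedule_def)

lemma even_part_simps [simp]: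
  "job (even_part m p j i) = j" "machine (even_part m p j i) = i"
  "start (even_part m p j i) = sum_list (take j p) / m"
  "finish (even_part m p j i) = sum_list (take (Suc j) p) / m"
  by (simp_all add: even_part_def)

lemma FP_instances_prefix_mono:
  assumes "p \<in> FP_instances" "j \<le> k"
  shows "sum_list (take j p) \<le> sum_list (take k p)"
proof -
  have "take k p = take j p @ take (k - j) (drop j p)"
    using assms(2) by (metis le_add_diff_inverse take_add)
  moreover have "0 \<le> sum_list (take (k - j) (drop j p))"
    using assms(1)
    by (intro sum_list_nonneg)
      (auto simp: FP_instances_def in_set_conv_nth dest!: in_set_takeD in_set_dropD
        intro: less_imp_le)
  ultimately show ?thesis by simp
qed

lemma even_schedule_feasible:
  assumes "m \<ge> 1" "p \<in> FP_instances"
  shows "even_schedule m p \<in> FP_schedules m p"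
proof -
  have pos: "p ! j > 0" if "j < length p" for j
    using assms(2) that by (auto simp: FP_instances_def)
  have nonneg: "0 \<le> sum_list (take j p)" for j
    using FP_instances_prefix_mono[OF assms(2), of 0 j] by simp
  \<comment> \<open>On one machine, job \<open>j\<close> ends at the scaled prefix sum up to
    \<open>Suc j\<close>, which is at most the start of any later job \<open>k\<close>. The case
    \<open>k < j\<close> follows by symmetry.\<close>
  have disj: "{start a..<finish a} \<inter> {start b..<finish b} = {}"
    if "a = even_part m p j i" "b = even_part m p k i" "j < k" for a b j k i
    using that FP_instances_prefix_mono[OF assms(2), of "Suc j" k] assms(1)
    by (auto simp: field_simps)
  have disj': "{start a..<finish a} \<inter> {start b..<finish b} = {}"
    if ab: "a \<in> even_schedule m p" "b \<in> even_schedule m p" "a \<noteq> b" "machine a = machine b" for a b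
  proof -
    obtain j k i where jk: "a = even_part m p j i" "b = even_part m p k i"
      using ab by (auto simp: even_schedule_def)
    with ab consider "j < k" | "k < j" by fastforce
    then show ?thesis using disj[OF jk] disj[OF jk(2,1)] by cases auto
  qed
  have total: "(\<Sum>a | a \<in> even_schedule m p \<and> job a = j. finish a - start a) = p ! j"
    if "j < length p" for j
  proof -
    have "{a \<in> even_schedule m p. job a = j} = even_part m p j ` {..<m}"
      using that by (auto simp: even_schedule_def)
    \<comment> \<open>The \<open>m\<close> parts of a job are distinct as records because they
      differ in \<open>machine\<close>, so none is lost when summing over the set.\<close>
    moreover have "inj_on (even_part m p j) {..<m}"
      by (rule inj_on_inverseI[where g = machine]) simp
    ultimately have "(\<Sum>a | a \<in> even_schedule m p \<and> job a = j. finish a - start a)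
        = (\<Sum>i<m. p ! j / m)"
      using that by (simp add: sum.reindex take_Suc_conv_app_nth add_divide_distrib)
    then show ?thesis using assms(1) by simp
  qed
  have "job a < length p \<and> machine a < m \<and> 0 \<le> start a \<and> start a < finish a"
    if "a \<in> even_schedule m p" for a
    using that assms(1) pos nonneg
    by (auto simp: even_schedule_def take_Suc_conv_app_nth divide_strict_right_mono)
  then show ?thesis
    using disj' total finite_even_schedule unfolding FP_schedules_def by blast
qed

lemma machine_load_even_schedule:
  assumes "p \<in> FP_instances" "i < m"
  shows "machine_load (even_schedule m p) i = sum_list p / m"
proof -
  have parts: "{a \<in> even_schedule m p. machine a = i} = (\<lambda>j. even_part m p j i) ` {..<length p}"
    using assms(2) by (auto simp: even_schedule_def)
  have p: "p \<noteq> []" using assms(1) by (simp add: FP_instances_def)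
  \<comment> \<open>Taking \<open>max\<close> also covers \<open>j\<close> beyond the length, where
    \<open>take\<close> returns all of \<open>p\<close>. The case \<open>j = 0\<close> later bounds
    the default value 0 inside the maximum.\<close>
  have le: "sum_list (take j p) / m \<le> sum_list p / m" for j
    using FP_instances_prefix_mono[OF assms(1), of j "max j (length p)"]
    by (simp add: divide_right_mono)
  show ?thesis unfolding machine_load_def parts
  proof (rule Max_eqI)
    fix y assume "y \<in> insert 0 (finish ` (\<lambda>j. even_part m p j i) ` {..<length p})"
    then show "y \<le> sum_list p / m" using le le[of 0] by auto
  next
    \<comment> \<open>The maximum is attained by the part of the last job.\<close>
    have "sum_list p / m = finish (even_part m p (length p - 1) i)" using p by simp
    then show "sum_list p / m \<in> insert 0 (finish ` (\<lambda>j. even_part m p j i) ` {..<length p})"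
      using p by (metis diff_less imageI insertI2 length_greater_0_conv lessThan_iff zero_less_one)
  qed simp
qed

lemma FP_instances_sum_list_pos: "p \<in> FP_instances \<Longrightarrow> 0 < sum_list p"
  unfolding sum_nth_eq_sum_list[symmetric] FP_instances_def by (intro sum_pos) auto

lemma sum_list_loads: "sum_list (map (machine_load S) [0..<m]) = (\<Sum>i<m. machine_load S i)"
  by (simp add: interv_sum_list_conv_sum_set_nat atLeast0LessThan)

lemma s_star_Pm_FP:
  assumes "m \<ge> 1" "p \<in> FP_instances"
  shows "s_star (Pm_FP m) p = 1"
proof (rule antisym)
  let ?loads = "\<lambda>S. map (machine_load S) [0..<m]"
  show "1 \<le> s_star (Pm_FP m) p"
    unfolding s_star_def s_ratio_def Pm_FP_def sched_problem.simps
  proof (intro INF_greatest)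
    fix S and \<alpha> :: real
    assume S: "S \<in> FP_schedules m p"
      and \<alpha>: "\<alpha> \<in> {\<alpha>. \<forall>T\<in>FP_schedules m p. ?loads S \<preceq>\<^sub>s map ((*) \<alpha>) (?loads T)}"
    \<comment> \<open>Any admissible factor must in particular work for \<open>T = S\<close>; as the
      total load is positive, this forces \<alpha> to be at least 1.\<close>
    then have "sum_list (?loads S) \<le> sum_list (map ((*) \<alpha>) (?loads S))"
      by (intro s_le_imp_sum_list_le) auto
    also have "\<dots> = \<alpha> * sum_list (?loads S)"
      by (rule sum_list_const_mult[of \<alpha> "\<lambda>x. x", simplified])
    finally have "sum_list (?loads S) \<le> \<alpha> * sum_list (?loads S)" .
    moreover have "0 < sum_list (?loads S)"
      using sum_processing_le_sum_loads[OF S] FP_instances_sum_list_pos[OF assms(2)]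
      by (simp add: sum_list_loads)
    ultimately show "1 \<le> ereal \<alpha>" by simp
  qed
  have "?loads (even_schedule m p) = replicate m (sum_list p / m)"
    using machine_load_even_schedule[OF assms(2)] by (intro nth_equalityI) auto
  \<comment> \<open>The factor 1 is thus admissible for the even schedule, which bounds both nested
    infima by 1.\<close>
  then have "?loads (even_schedule m p) \<preceq>\<^sub>s map ((*) 1) (?loads T)" if "T \<in> FP_schedules m p" for T
    using sum_processing_le_sum_loads[OF that] assms(1)
    by (simp add: sum_list_loads comp_def replicate_s_le)
  then show "s_star (Pm_FP m) p \<le> 1"
    unfolding s_star_def s_ratio_def Pm_FP_def sched_problem.simps one_ereal_def
    using even_schedule_feasible[OF assms]
    by (intro INF_lower2[of "even_schedule m p"] INF_lower) auto
qed

theorem theorem5: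
  fixes m :: nat
  assumes "m \<ge> 1"
  shows "WAR (Pm_FP m) = 1"
proof -
  \<comment> \<open>A supremum of the constant 1 is 1 only over a nonempty set; over the empty set
    it would be minus infinity.\<close>
  have "[1] \<in> FP_instances" by (simp add: FP_instances_def)
  then have "FP_instances \<noteq> {}" by blast
  then show ?thesis
    using s_star_Pm_FP[OF assms] by (simp add: WAR_def Pm_FP_def)
qed

end
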